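(* Let $\theta$, $x$ and $y$ be fixed, let $\omega$ be a frequency, $T=2\pi/\omega$, let $\alpha>0$ be a constant and $\gamma>0$ a small constant. Let $$v(t)=\underset{v}{\arg\min}\;\bigl[E(\theta,x,v)+\gamma\sin(\omega t)\,C(v,y)\bigr]$$ be the response of the network at time $t$ to the sinusoidal nudging, let $$a=\frac1T\int_0^T v(t)\,dt,\qquad b=\frac2T\int_0^T v(t)\sin(\omega t)\,dt$$ be its first two vectors of Fourier coefficients, $a=(a_1,\dots,a_N)$, $b=(b_1,\dots,b_N)$, and let each parameter $\theta_{jk}$ be updated according to the learning rule $$\Delta\theta_{jk}=-\alpha\,(b_j-b_k)\cdot(a_j-a_k).$$ Then for every parameter $\theta_{jk}$, $$\Delta\theta_{jk}=-\alpha\,\gamma\,\frac{\partial\mathcal{L}}{\partial\theta_{jk}}(\theta,x,y)+O(\gamma^3)\qquad\text{when }\gamma\to0,$$ where $\mathcal{L}(\theta,x,y)=C(v(\theta,x),y)$ and $v(\theta,x)=\arg\min_{v}E(\theta,x,v)$.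
   Context: Setting (nonlinear resistive network): an electrical circuit of $N$ nodes interconnected by resistive devices (branches), some of them linear resistors and others nonlinear (e.g. diodes). $v=(v_1,\dots,v_N)$ is the configuration of the nodes' electric potentials. $\theta=\{\theta_{jk}:\text{linear branch }(j,k)\}$ is the vector of conductances of the linear branches; these are the trainable parameters. $x=(x_1,\dots,x_N)$ is the vector of input signals, with $x_j=0$ if node $j$ is not an input node. The energy function (co-content) of the network is $$E(\theta,x,v)=E_{\rm input}(x,v)+E_{\rm nonlinear}(v)+\sum_{\text{linear branch }(j,k)}\tfrac12\,\theta_{jk}\,(v_j-v_k)^2,$$ where $E_{\rm input}(x,v)$ is a function of $x$ and $v$, and $E_{\rm nonlinear}(v)$ is a function of $v$ only. Here $E_{\rm nonlinear}(v)=\sum_{\text{nonlinear branch }(j,k)}\int_0^{v_j-v_k}\widehat{i}_{jk}(v')\,dv'$, where $\widehat{i}_{jk}$ is the real-valued current-voltage characteristic of branch $(j,k)$. The input term is either $\sum_{j\text{ input node}}x_jv_j$ (boundary currents), or $0$ if $v_j=x_j$ for every input node $j$ and $+\infty$ otherwise (boundary electric potentials). The equilibrium state of the network given $\theta$ and $x$ is $v(\theta,x)=\arg\min_vE(\theta,x,v)$. $C(v,y)$ is a cost function measuring the discrepancy between the configuration $v$ and the desired output $y$, and $\mathcal{L}(\theta,x,y)=C(v(\theta,x),y)$ is the per-example loss function.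
   Formalization: The formal theorem adds regularity the English omits and needs: near (θ_jk, 0) minimisers of E+βC exist and can be chosen three times continuously differentiable jointly in θ_jk and the nudging strength β, and C(·,y) is differentiable at the equilibrium v(θ,x). *)

theory Defs
  imports "HOL-Analysis.Analysis" "HOL-Library.Landau_Symbols"
begin

text \<open>
  Nodes are the elements of a finite type \<open>'n\<close>, so configurations of node potentials and input
  signals are vectors in \<open>real ^ 'n\<close>. A branch is the pair of its end
  nodes in a chosen orientation (which matters only for the characteristics);
  \<open>(j, k)\<close> and \<open>(k, j)\<close>, if both present, are parallel branches.
\<close>

datatype input_mode = Boundary_Currents | Boundary_Potentials

record 'n network =
  input_nodes :: "'n set"
  input_mode :: input_mode
  linear_branches :: "('n \<times> 'n) set"
  nonlinear_branches :: "('n \<times> 'n) set"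
  characteristic :: "'n \<times> 'n \<Rightarrow> real \<Rightarrow> real"

text \<open>
  The energy is extended-real valued because clamping the input nodes to prescribed potentials is
  encoded by the value \<open>\<infinity>\<close>.
\<close>

definition input_energy :: "'n::finite network \<Rightarrow> real ^ 'n \<Rightarrow> real ^ 'n \<Rightarrow> ereal" where
  "input_energy net x v =
    (case input_mode net of
       Boundary_Currents \<Rightarrow> ereal (\<Sum>j\<in>input_nodes net. x $ j * v $ j)
     | Boundary_Potentials \<Rightarrow> (if \<forall>j\<in>input_nodes net. v $ j = x $ j then 0 else \<infinity>))"

text \<open>The interval integral is oriented: it changes sign when \<open>v $ j - v $ k < 0\<close>.\<close>

definition nonlinear_energy :: "'n::finite network \<Rightarrow> real ^ 'n \<Rightarrow> real" where
  "nonlinear_energy net v =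
    (\<Sum>(j, k)\<in>nonlinear_branches net.
       LBINT u=0..ereal (v $ j - v $ k). characteristic net (j, k) u)"

definition linear_energy ::
  "'n::finite network \<Rightarrow> ('n \<times> 'n \<Rightarrow> real) \<Rightarrow> real ^ 'n \<Rightarrow> real" where
  "linear_energy net \<theta> v =
    (\<Sum>(j, k)\<in>linear_branches net. 1 / 2 * \<theta> (j, k) * (v $ j - v $ k)\<^sup>2)"

definition energy ::
  "'n::finite network \<Rightarrow> ('n \<times> 'n \<Rightarrow> real) \<Rightarrow> real ^ 'n \<Rightarrow> real ^ 'n \<Rightarrow> ereal" where
  "energy net \<theta> x v =
    input_energy net x v + ereal (nonlinear_energy net v) + ereal (linear_energy net \<theta> v)"

definition is_nudged_state ::
  "'n::finite network \<Rightarrow> (real ^ 'n \<Rightarrow> 'y \<Rightarrow> real) \<Rightarrow> ('n \<times> 'n \<Rightarrow> real) \<Rightarrow> real ^ 'n \<Rightarrow> 'y \<Rightarrow>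
    real \<Rightarrow> real ^ 'n \<Rightarrow> bool" where
  "is_nudged_state net C \<theta> x y \<beta> v \<longleftrightarrow>
    is_arg_min (\<lambda>w. energy net \<theta> x w + ereal (\<beta> * C w y)) (\<lambda>_. True) v"

text \<open>
  In the following, \<open>V \<theta> \<beta>\<close> is the state of the network with conductances \<open>\<theta>\<close> under the
  nudging strength \<open>\<beta>\<close> (for a fixed input and a fixed desired output); \<open>V \<theta> 0\<close> is the
  equilibrium state.
\<close>

definition loss ::
  "(real ^ 'n \<Rightarrow> 'y \<Rightarrow> real) \<Rightarrow> (('n \<times> 'n \<Rightarrow> real) \<Rightarrow> real \<Rightarrow> real ^ 'n) \<Rightarrow> 'y \<Rightarrow>
    ('n \<times> 'n \<Rightarrow> real) \<Rightarrow> real" where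
  "loss C V y \<theta> = C (V \<theta> 0) y"

definition fourier_mean :: "real \<Rightarrow> (real \<Rightarrow> real ^ 'n::finite) \<Rightarrow> real ^ 'n" where
  "fourier_mean \<omega> f = (let T = 2 * pi / \<omega> in (1 / T) *\<^sub>R integral {0..T} f)"

definition fourier_sine :: "real \<Rightarrow> (real \<Rightarrow> real ^ 'n::finite) \<Rightarrow> real ^ 'n" where
  "fourier_sine \<omega> f =
    (let T = 2 * pi / \<omega> in (2 / T) *\<^sub>R integral {0..T} (\<lambda>t. sin (\<omega> * t) *\<^sub>R f t))"

definition conductance_update ::
  "real \<Rightarrow> real \<Rightarrow> (real \<Rightarrow> real ^ 'n::finite) \<Rightarrow> 'n \<Rightarrow> 'n \<Rightarrow> real" where
  "conductance_update \<alpha> \<omega> f j k =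
    (let a = fourier_mean \<omega> f; b = fourier_sine \<omega> f
     in - \<alpha> * (b $ j - b $ k) * (a $ j - a $ k))"

text \<open>
  \<open>cont_diff_on n f S\<close> says that \<open>f\<close> is \<open>n\<close> times continuously differentiable on \<open>S\<close>. It is
  meant for open \<open>S\<close>, since derivatives are taken in full neighbourhoods.
\<close>

primrec cont_diff_on ::
  "nat \<Rightarrow> ('a::euclidean_space \<Rightarrow> 'b::real_normed_vector) \<Rightarrow> 'a set \<Rightarrow> bool" where
  "cont_diff_on 0 f S \<longleftrightarrow> continuous_on S f"
| "cont_diff_on (Suc n) f S \<longleftrightarrow>
    (\<forall>z\<in>S. f differentiable (at z)) \<and>
    (\<forall>i\<in>Basis. cont_diff_on n (\<lambda>z. frechet_derivative f (at z) i) S)"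

end

theory Submission
  imports Defs
begin

text \<open>
  As a minimum of functions that are affine in \<open>(\<theta>\<^sub>j\<^sub>k, \<beta>)\<close>, the minimal total energy is concave in
  these two variables, and \<open>((v\<^sub>j - v\<^sub>k)\<^sup>2 / 2, C v y)\<close> evaluated at the nudged state is a
  supergradient. The symmetry of second derivatives of the minimal energy therefore gives
  \<open>\<partial>L / \<partial>\<theta>\<^sub>j\<^sub>k = \<partial> ((v\<^sub>j - v\<^sub>k)\<^sup>2 / 2) / \<partial>\<beta>\<close> at \<open>\<beta> = 0\<close>. Since \<open>sin\<close> and \<open>sin\<^sup>3\<close>
  have mean zero over a period, expanding the response to order three in \<open>\<gamma>\<close> shows
  \<open>a = v + O(\<gamma>\<^sup>2)\<close> and \<open>b = \<gamma> \<partial>v / \<partial>\<beta> + O(\<gamma>\<^sup>3)\<close>, and the product of the two differences of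
  coefficients is this partial derivative times \<open>\<gamma>\<close>, up to \<open>O(\<gamma>\<^sup>3)\<close>.
\<close>

section \<open>Mixed second derivatives of a minimal value\<close>

text \<open>
  The cost \<open>c\<close> is only differentiable at \<open>p\<close>, so Schwarz' theorem does not apply. Instead, the mixed
  difference of \<open>F\<close> over a rectangle with sides \<open>t\<close> and \<open>e * t\<close> is computed by the mean value theorem
  on the \<open>g\<close> side and estimated by the supergradient inequality on the \<open>c\<close> side; the thin shape makes
  the contribution of the unwanted derivative \<open>c' (0, 1)\<close> negligible.
\<close>
lemma envelope_mixed_partial:
  fixes F g h c :: "real \<times> real \<Rightarrow> real"
  assumes U: "open U" "p \<in> U"
    and env: "\<And>z w. z \<in> U \<Longrightarrow> w \<in> U \<Longrightarrow>
      F w \<le> F z + (fst w - fst z) * g z + (snd w - snd z) * c z"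
    and g: "continuous_on U g"
    and h: "\<And>s \<beta>. (s, \<beta>) \<in> U \<Longrightarrow> ((\<lambda>\<beta>. g (s, \<beta>)) has_real_derivative h (s, \<beta>)) (at \<beta>)"
    and conth: "isCont h p"
    and c: "(c has_derivative c') (at p)"
  shows "c' (1, 0) = h p"
proof -
  obtain s0 b0 where p: "p = (s0, b0)" by fastforce
  define cs cb where "cs = c' (1, 0)" and "cb = c' (0, 1)"
  have c'_eq: "c' (x, y) = x * cs + y * cb" for x y
  proof -
    have lin: "linear c'" using c by (simp add: has_derivative_linear)
    have "(x, y) = x *\<^sub>R (1, 0) + y *\<^sub>R (0, 1)" by simp
    then have "c' (x, y) = c' (x *\<^sub>R (1, 0) + y *\<^sub>R (0, 1))" by simp
    also have "\<dots> = x * cs + y * cb"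
      unfolding linear_add[OF lin] linear_scale[OF lin] cs_def cb_def by simp
    finally show ?thesis .
  qed
  \<comment> \<open>\<open>e\<close> is at once the tolerance at \<open>p\<close> for the continuity
    of \<open>h\<close> and the differentiability of \<open>c\<close>, and the ratio of the sides of
    the rectangle. On the right, 4 comes from evaluating \<open>c\<close> at two corners, 1 from
    replacing \<open>h\<close> at an inner point by \<open>h p\<close>, and
    \<open>\<bar>cb\<bar>\<close> from the short side.\<close>
  have bound: "\<bar>h p - cs\<bar> \<le> e * (5 + \<bar>cb\<bar>)" if e: "0 < e" "e \<le> 1" for e
  proof -
    obtain r1 where r1: "r1 > 0" "ball p r1 \<subseteq> U"
      using U open_contains_ball by blast
    obtain r2 where r2: "r2 > 0" "\<And>z. dist z p < r2 \<Longrightarrow> \<bar>h z - h p\<bar> < e"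
      using conth e unfolding continuous_at_eps_delta dist_real_def by blast
    obtain r3 where r3: "r3 > 0"
      "\<And>z. norm (z - p) < r3 \<Longrightarrow> \<bar>c z - c p - c' (z - p)\<bar> \<le> e * norm (z - p)"
      using c e unfolding has_derivative_at_alt real_norm_def by metis
    \<comment> \<open>A point whose two coordinates are within \<open>t\<close> of those of
      \<open>p\<close> has distance at most \<open>2 * t\<close> from \<open>p\<close>, which is
      below the smallest of the three radii.\<close>
    define t where "t = min r1 (min r2 r3) / 3"
    have t: "t > 0" using r1 r2 r3 by (simp add: t_def)
    define u where "u = e * t"
    have u: "0 < u" "u \<le> t" using e t by (auto simp: u_def)
    have near: "norm ((s, \<beta>) - p) < min r1 (min r2 r3)" if "\<bar>s - s0\<bar> \<le> t" "\<bar>\<beta> - b0\<bar> \<le> t" for s \<beta>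
    proof -
      have "norm ((s, \<beta>) - p) \<le> \<bar>s - s0\<bar> + \<bar>\<beta> - b0\<bar>"
        unfolding p using norm_Pair_le[of "s - s0" "\<beta> - b0"] by simp
      also have "\<dots> < 3 * t" using that t by linarith
      finally show ?thesis unfolding t_def by simp
    qed
    have inU: "(s, \<beta>) \<in> U" if "\<bar>s - s0\<bar> \<le> t" "\<bar>\<beta> - b0\<bar> \<le> t" for s \<beta>
    proof -
      have "(s, \<beta>) \<in> ball p r1"
        using near[OF that] by (simp add: dist_norm norm_minus_commute)
      then show ?thesis using r1 by blast
    qed
    have hb: "\<bar>h (s, \<beta>) - h p\<bar> < e" if "\<bar>s - s0\<bar> \<le> t" "\<bar>\<beta> - b0\<bar> \<le> t" for s \<beta>
      using near[OF that] by (intro r2(2)) (simp add: dist_norm)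
    have cbnd: "\<bar>c (s, \<beta>) - c p - (s - s0) * cs - (\<beta> - b0) * cb\<bar> \<le> e * (2 * t)"
      if "\<bar>s - s0\<bar> \<le> t" "\<bar>\<beta> - b0\<bar> \<le> t" for s \<beta>
    proof -
      have "norm ((s, \<beta>) - p) \<le> \<bar>s - s0\<bar> + \<bar>\<beta> - b0\<bar>"
        unfolding p using norm_Pair_le[of "s - s0" "\<beta> - b0"] by simp
      also have "\<dots> \<le> 2 * t" using that by linarith
      finally have "e * norm ((s, \<beta>) - p) \<le> e * (2 * t)" using e by simp
      moreover have "\<bar>c (s, \<beta>) - c p - c' ((s, \<beta>) - p)\<bar> \<le> e * norm ((s, \<beta>) - p)"
        using near[OF that] by (intro r3(2)) simp
      moreover have "c' ((s, \<beta>) - p) = (s - s0) * cs + (\<beta> - b0) * cb"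
        by (simp add: p c'_eq)
      ultimately show ?thesis by linarith
    qed
    \<comment> \<open>With \<beta> fixed the \<open>c\<close> term of \<open>env\<close> vanishes.
      Using \<open>env\<close> in both directions traps the difference quotient of \<open>F\<close>
      between the values of \<open>g\<close> at the two points, and these merge because
      \<open>g\<close> is continuous.\<close>
    have dF: "((\<lambda>s. F (s, \<beta>)) has_real_derivative g (s, \<beta>)) (at s)" if "(s, \<beta>) \<in> U" for s \<beta>
    proof -
      have op: "\<forall>\<^sub>F s' in at s. (s', \<beta>) \<in> U"
      proof -
        have "((\<lambda>s'. (s', \<beta>)) \<longlongrightarrow> (s, \<beta>)) (at s)" by (intro tendsto_intros)
        from topological_tendstoD[OF this \<open>open U\<close> that] show ?thesis .
      qed
      have gc: "isCont g (s, \<beta>)" using g \<open>open U\<close> that continuous_on_eq_continuous_at by blast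
      have lim: "((\<lambda>s'. g (s', \<beta>)) \<longlongrightarrow> g (s, \<beta>)) (at s)"
        by (rule isCont_tendsto_compose[OF gc]) (intro tendsto_intros)
      have "((\<lambda>s'. (F (s', \<beta>) - F (s, \<beta>)) / (s' - s) - g (s, \<beta>)) \<longlongrightarrow> 0) (at s)"
      proof (rule Lim_null_comparison)
        show "((\<lambda>s'. \<bar>g (s', \<beta>) - g (s, \<beta>)\<bar>) \<longlongrightarrow> 0) (at s)"
          using lim by (simp add: tendsto_rabs_zero_iff LIM_zero_iff)
        show "\<forall>\<^sub>F s' in at s. norm ((F (s', \<beta>) - F (s, \<beta>)) / (s' - s) - g (s, \<beta>))
            \<le> \<bar>g (s', \<beta>) - g (s, \<beta>)\<bar>"
          using op eventually_neq_at_within[of s s]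
        proof eventually_elim
          case (elim s')
          define q where "q = (F (s', \<beta>) - F (s, \<beta>)) / (s' - s)"
          have q: "F (s', \<beta>) - F (s, \<beta>) = (s' - s) * q" using elim by (simp add: q_def)
          have 1: "(s' - s) * q \<le> (s' - s) * g (s, \<beta>)"
            using env[OF that elim(1)] q by simp
          have 2: "(s' - s) * g (s', \<beta>) \<le> (s' - s) * q"
            using env[OF elim(1) that] q by (simp add: algebra_simps)
          have "\<bar>q - g (s, \<beta>)\<bar> \<le> \<bar>g (s', \<beta>) - g (s, \<beta>)\<bar>"
          proof (cases "s' > s")
            case True
            then show ?thesis using 1 2 by simp
          next
            case False
            then have "s' < s" using elim by simp
            then show ?thesis using 1 2 by (simp add: mult_le_cancel_left)
          qed
          then show ?case by (simp add: q_def)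
        qed
      qed
      then show ?thesis by (simp add: has_field_derivative_iff LIM_zero_iff)
    qed
    \<comment> \<open>The mixed second difference of \<open>F\<close>. The mean value theorem in the
      first variable turns it into a difference of \<open>g\<close>, and a second application, in
      \<beta>, into \<open>t * u * h (\<xi>, \<zeta>)\<close>.\<close>
    define D where "D = F (s0 + t, b0 + u) - F (s0 + t, b0) - F (s0, b0 + u) + F (s0, b0)"
    have "\<exists>\<xi>. s0 < \<xi> \<and> \<xi> < s0 + t \<and>
        (F (s0 + t, b0 + u) - F (s0 + t, b0)) - (F (s0, b0 + u) - F (s0, b0))
        = (s0 + t - s0) * (g (\<xi>, b0 + u) - g (\<xi>, b0))"
      using t u by (intro MVT2 DERIV_diff dF inU) auto
    then obtain \<xi> where \<xi>: "s0 < \<xi>" "\<xi> < s0 + t" "D = t * (g (\<xi>, b0 + u) - g (\<xi>, b0))"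
      by (auto simp: D_def)
    have "\<exists>\<zeta>. b0 < \<zeta> \<and> \<zeta> < b0 + u \<and>
        g (\<xi>, b0 + u) - g (\<xi>, b0) = (b0 + u - b0) * h (\<xi>, \<zeta>)"
      using t u \<xi> by (intro MVT2 h inU) auto
    then obtain \<zeta> where \<zeta>: "b0 < \<zeta>" "\<zeta> < b0 + u" "D = t * u * h (\<xi>, \<zeta>)"
      using \<xi> by auto
    have h1: "\<bar>h (\<xi>, \<zeta>) - h p\<bar> < e" using \<xi> \<zeta> u by (intro hb) auto
    have inUs: "(s0, b0) \<in> U" "(s0 + t, b0) \<in> U" "(s0, b0 + u) \<in> U" "(s0 + t, b0 + u) \<in> U"
      using t u by (auto intro!: inU)
    \<comment> \<open>The two increments of \<open>F\<close> along the short side are bounded by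
      supergradients taken at \<open>(s0 + t, b0)\<close> and \<open>(s0, b0 + u)\<close>. These
      corners differ by \<open>(t, - u)\<close>, so after division by \<open>u\<close> the
      derivative \<open>cb\<close> enters only with the weight \<open>u = e * t\<close>.\<close>
    have "D \<le> u * c (s0 + t, b0) - u * c (s0, b0 + u)"
      using env[OF inUs(2,4)] env[OF inUs(3,1)] unfolding D_def by simp
    also have "\<dots> = u * (c (s0 + t, b0) - c (s0, b0 + u))" by (simp add: algebra_simps)
    finally have "t * h (\<xi>, \<zeta>) \<le> c (s0 + t, b0) - c (s0, b0 + u)"
      using u unfolding \<zeta>(3) by (simp add: mult.left_commute[of _ u])
    also have "\<dots> \<le> t * cs - u * cb + 4 * e * t"
      using cbnd[of "s0 + t" b0] cbnd[of s0 "b0 + u"] t u by (simp add: abs_le_iff algebra_simps)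
    also have "\<dots> = t * (cs - e * cb + 4 * e)" by (simp add: u_def algebra_simps)
    finally have up: "h (\<xi>, \<zeta>) \<le> cs - e * cb + 4 * e" using t by simp
    \<comment> \<open>Supergradients at the other two corners, which differ by
      \<open>(t, u)\<close>, give the reverse bound.\<close>
    have "D \<ge> u * c (s0 + t, b0 + u) - u * c (s0, b0)"
      using env[OF inUs(4,2)] env[OF inUs(1,3)] unfolding D_def by simp
    moreover have "u * c (s0 + t, b0 + u) - u * c (s0, b0) = u * (c (s0 + t, b0 + u) - c (s0, b0))"
      by (simp add: algebra_simps)
    ultimately have "t * h (\<xi>, \<zeta>) \<ge> c (s0 + t, b0 + u) - c (s0, b0)"
      using u unfolding \<zeta>(3) by (simp add: mult.left_commute[of _ u])
    moreover have "c (s0 + t, b0 + u) - c (s0, b0) \<ge> t * cs + u * cb - 4 * e * t"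
      using cbnd[of "s0 + t" "b0 + u"] t u e by (simp add: abs_le_iff p)
    moreover have "t * cs + u * cb - 4 * e * t = t * (cs + e * cb - 4 * e)"
      by (simp add: u_def algebra_simps)
    ultimately have "t * (cs + e * cb - 4 * e) \<le> t * h (\<xi>, \<zeta>)" by linarith
    then have lo: "cs + e * cb - 4 * e \<le> h (\<xi>, \<zeta>)" using t by simp
    have "\<bar>e * cb\<bar> = e * \<bar>cb\<bar>" using e by (simp add: abs_mult)
    with up lo h1 show ?thesis by (simp add: algebra_simps)
  qed
  have "h p - cs = 0"
  proof (rule ccontr)
    assume neq: "h p - cs \<noteq> 0"
    \<comment> \<open>Chosen so that \<open>bound\<close> gives at most half of the supposedly
      nonzero distance.\<close>
    define e where "e = min 1 (\<bar>h p - cs\<bar> / (2 * (5 + \<bar>cb\<bar>)))"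
    have e: "0 < e" "e \<le> 1" using neq by (auto simp: e_def intro!: divide_pos_pos add_pos_nonneg)
    have "e * (5 + \<bar>cb\<bar>) \<le> \<bar>h p - cs\<bar> / (2 * (5 + \<bar>cb\<bar>)) * (5 + \<bar>cb\<bar>)"
      by (intro mult_right_mono) (auto simp: e_def)
    also have "\<dots> = \<bar>h p - cs\<bar> / 2"
    proof -
      have "5 + \<bar>cb\<bar> \<noteq> 0" by linarith
      then show ?thesis by (metis divide_divide_eq_left nonzero_eq_divide_eq)
    qed
    finally have "\<bar>h p - cs\<bar> \<le> \<bar>h p - cs\<bar> / 2" using bound[OF e] by linarith
    then show False using neq by simp
  qed
  then show ?thesis by (simp add: cs_def)
qed

section \<open>Fourier coefficients of a response to a small sinusoid\<close>

lemma has_integral_sin_powers_period: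
  fixes \<omega> :: real
  assumes "\<omega> > 0"
  shows "((\<lambda>t. sin (\<omega> * t)) has_integral 0) {0..2 * pi / \<omega>}"
    and "((\<lambda>t. sin (\<omega> * t) ^ 2) has_integral pi / \<omega>) {0..2 * pi / \<omega>}"
    and "((\<lambda>t. sin (\<omega> * t) ^ 3) has_integral 0) {0..2 * pi / \<omega>}"
proof -
  have T: "0 \<le> 2 * pi / \<omega>" "\<omega> * (2 * pi / \<omega>) = 2 * pi" using assms by auto
  have cos2: "cos x ^ 2 = 1 - sin x ^ 2" for x :: real by (simp add: cos_squared_eq)
  have "((\<lambda>t. sin (\<omega> * t)) has_integral
      (- cos (\<omega> * (2 * pi / \<omega>)) / \<omega> - (- cos (\<omega> * 0) / \<omega>))) {0..2 * pi / \<omega>}"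
    using assms T(1)
    by (intro fundamental_theorem_of_calculus)
      (auto intro!: derivative_eq_intros simp flip: has_real_derivative_iff_has_vector_derivative)
  then show "((\<lambda>t. sin (\<omega> * t)) has_integral 0) {0..2 * pi / \<omega>}"
    unfolding T(2) by simp
  have "((\<lambda>t. sin (\<omega> * t) ^ 2) has_integral
      ((2 * pi / \<omega>) / 2 - sin (\<omega> * (2 * pi / \<omega>)) * cos (\<omega> * (2 * pi / \<omega>)) / (2 * \<omega>)
        - (0 / 2 - sin (\<omega> * 0) * cos (\<omega> * 0) / (2 * \<omega>)))) {0..2 * pi / \<omega>}"
  proof (intro fundamental_theorem_of_calculus T(1))
    fix t
    have "((\<lambda>t. t / 2 - sin (\<omega> * t) * cos (\<omega> * t) / (2 * \<omega>)) has_real_derivative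
       (1 / 2 - (cos (\<omega> * t) * \<omega> * cos (\<omega> * t) - sin (\<omega> * t) * (sin (\<omega> * t) * \<omega>)) / (2 * \<omega>)))
       (at t within {0..2 * pi / \<omega>})"
      using assms by (auto intro!: derivative_eq_intros simp: field_simps)
    also have "1 / 2 - (cos (\<omega> * t) * \<omega> * cos (\<omega> * t) - sin (\<omega> * t) * (sin (\<omega> * t) * \<omega>)) / (2 * \<omega>)
        = 1 / 2 - (cos (\<omega> * t) ^ 2 - sin (\<omega> * t) ^ 2) / 2"
      using assms by (simp add: field_simps power2_eq_square)
    also have "\<dots> = sin (\<omega> * t) ^ 2" by (simp add: cos2 field_simps)
    finally show "((\<lambda>t. t / 2 - sin (\<omega> * t) * cos (\<omega> * t) / (2 * \<omega>)) has_vector_derivative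
       sin (\<omega> * t) ^ 2) (at t within {0..2 * pi / \<omega>})"
      by (simp flip: has_real_derivative_iff_has_vector_derivative)
  qed
  then show "((\<lambda>t. sin (\<omega> * t) ^ 2) has_integral pi / \<omega>) {0..2 * pi / \<omega>}"
    unfolding T(2) by simp
  have "((\<lambda>t. sin (\<omega> * t) ^ 3) has_integral
      (- cos (\<omega> * (2 * pi / \<omega>)) / \<omega> + cos (\<omega> * (2 * pi / \<omega>)) ^ 3 / (3 * \<omega>)
        - (- cos (\<omega> * 0) / \<omega> + cos (\<omega> * 0) ^ 3 / (3 * \<omega>)))) {0..2 * pi / \<omega>}"
  proof (intro fundamental_theorem_of_calculus T(1))
    fix t
    have "((\<lambda>t. - cos (\<omega> * t) / \<omega> + cos (\<omega> * t) ^ 3 / (3 * \<omega>)) has_real_derivative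
       (sin (\<omega> * t) * \<omega> / \<omega> - 3 * cos (\<omega> * t) ^ 2 * (sin (\<omega> * t) * \<omega>) / (3 * \<omega>)))
       (at t within {0..2 * pi / \<omega>})"
      using assms by (auto intro!: derivative_eq_intros)
    also have "sin (\<omega> * t) * \<omega> / \<omega> - 3 * cos (\<omega> * t) ^ 2 * (sin (\<omega> * t) * \<omega>) / (3 * \<omega>)
        = sin (\<omega> * t) ^ 3"
      using assms unfolding cos2 by (simp add: field_simps power2_eq_square power3_eq_cube)
    finally show "((\<lambda>t. - cos (\<omega> * t) / \<omega> + cos (\<omega> * t) ^ 3 / (3 * \<omega>)) has_vector_derivative
       sin (\<omega> * t) ^ 3) (at t within {0..2 * pi / \<omega>})"
      by (simp flip: has_real_derivative_iff_has_vector_derivative)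
  qed
  then show "((\<lambda>t. sin (\<omega> * t) ^ 3) has_integral 0) {0..2 * pi / \<omega>}"
    unfolding T(2) by simp
qed

lemma abs_integral_diff_le:
  fixes f q :: "real \<Rightarrow> real"
  assumes "a \<le> b" "0 \<le> B" "f integrable_on {a..b}" "(q has_integral I) {a..b}"
    and "\<And>t. t \<in> {a..b} \<Longrightarrow> \<bar>f t - q t\<bar> \<le> B"
  shows "\<bar>integral {a..b} f - I\<bar> \<le> B * (b - a)"
proof -
  have "((\<lambda>t. f t - q t) has_integral (integral {a..b} f - I)) {a..b}"
    using assms by (intro has_integral_diff) auto
  from has_integral_bound_real[OF _ _ this, of B "{}"] assms show ?thesis by simp
qed

text \<open>The Taylor polynomial is integrated exactly and its remainder is estimated uniformly in
  time. For the mean, only the linear term has to cancel, and the quadratic one is part of the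
  error. For the sine coefficient, the extra factor turns the constant and quadratic terms into odd
  powers of the sine, which integrate to zero, so the error is of order three.\<close>

lemma fourier_coefficients_sinusoidal:
  fixes d :: "real \<Rightarrow> real" and \<omega> :: real
  defines "T \<equiv> 2 * pi / \<omega>"
  assumes \<omega>: "\<omega> > 0" and r: "r > 0" and cont: "continuous_on {-r..r} d"
    and taylor: "\<And>\<beta>. \<bar>\<beta>\<bar> \<le> r \<Longrightarrow> \<bar>d \<beta> - (d0 + d1 * \<beta> + d2 * \<beta>\<^sup>2)\<bar> \<le> K * \<bar>\<beta>\<bar> ^ 3"
  shows "(\<lambda>\<gamma>. (1 / T) * integral {0..T} (\<lambda>t. d (\<gamma> * sin (\<omega> * t))) - d0)
      \<in> O[at_right 0](\<lambda>\<gamma>. \<gamma> ^ 2)" (is ?mean)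
    and "(\<lambda>\<gamma>. (2 / T) * integral {0..T} (\<lambda>t. sin (\<omega> * t) * d (\<gamma> * sin (\<omega> * t))) - \<gamma> * d1)
      \<in> O[at_right 0](\<lambda>\<gamma>. \<gamma> ^ 3)" (is ?sine)
proof -
  have T: "T > 0" using \<omega> by (simp add: T_def)
  have "0 \<le> K * \<bar>r\<bar> ^ 3" using taylor[of r] r by (smt (verit))
  then have K: "K \<ge> 0" using r by (simp add: zero_le_mult_iff)
  note sins = has_integral_sin_powers_period[OF \<omega>, folded T_def]
  have ev: "\<forall>\<^sub>F \<gamma> in at_right 0. 0 < \<gamma> \<and> \<gamma> < r"
    using eventually_at_right_real[OF r] by eventually_elim auto
  have small: "\<bar>\<gamma> * sin (\<omega> * t)\<bar> \<le> \<gamma>" if "0 < \<gamma>" for \<gamma> t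
    using that by (simp add: abs_mult mult_left_le)
  have cubic: "\<bar>d (\<gamma> * sin (\<omega> * t)) - (d0 + d1 * (\<gamma> * sin (\<omega> * t)) + d2 * (\<gamma> * sin (\<omega> * t))\<^sup>2)\<bar>
      \<le> K * \<gamma> ^ 3" if "0 < \<gamma>" "\<gamma> < r" for \<gamma> t
  proof -
    have "\<bar>\<gamma> * sin (\<omega> * t)\<bar> ^ 3 \<le> \<gamma> ^ 3" using small[OF that(1)] by (intro power_mono) auto
    then have "K * \<bar>\<gamma> * sin (\<omega> * t)\<bar> ^ 3 \<le> K * \<gamma> ^ 3" using K by (rule mult_left_mono)
    then show ?thesis using taylor[of "\<gamma> * sin (\<omega> * t)"] small[OF that(1), of t] that by linarith
  qed
  have contd: "continuous_on {0..T} (\<lambda>t. d (\<gamma> * sin (\<omega> * t)))" if "0 < \<gamma>" "\<gamma> < r" for \<gamma>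
  proof -
    have "\<gamma> * sin (\<omega> * t) \<in> {-r..r}" for t
      using small[OF that(1), of t] that by (simp only: atLeastAtMost_iff abs_le_iff) linarith
    then show ?thesis by (intro continuous_on_compose2[OF cont] continuous_intros) auto
  qed
  show ?mean
  \<comment> \<open>\<open>\<bar>d2\<bar>\<close> pays for the quadratic term, and
    \<open>K * r\<close> for the cubic remainder, since \<gamma> < r.\<close>
  proof (rule bigoI[where c = "\<bar>d2\<bar> + K * r"])
    show "\<forall>\<^sub>F \<gamma> in at_right 0. norm ((1 / T) * integral {0..T} (\<lambda>t. d (\<gamma> * sin (\<omega> * t))) - d0)
        \<le> (\<bar>d2\<bar> + K * r) * norm (\<gamma> ^ 2)"
      using ev
    proof eventually_elim
      case (elim \<gamma>)
      have q: "((\<lambda>t. d0 + d1 * \<gamma> * sin (\<omega> * t)) has_integral d0 * T) {0..T}"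
        using has_integral_add[OF has_integral_const_real[of d0 0 T]
            has_integral_mult_right[OF sins(1), of "d1 * \<gamma>"]] T
        by (simp add: mult.commute)
      have "\<bar>integral {0..T} (\<lambda>t. d (\<gamma> * sin (\<omega> * t))) - d0 * T\<bar>
          \<le> (\<bar>d2\<bar> + K * r) * \<gamma>\<^sup>2 * (T - 0)"
      proof (rule abs_integral_diff_le[OF _ _ _ q])
        fix t
        have "\<bar>\<gamma> * sin (\<omega> * t)\<bar>\<^sup>2 \<le> \<gamma>\<^sup>2" using small[of \<gamma> t] elim by (intro power_mono) auto
        then have "\<bar>d2\<bar> * \<bar>\<gamma> * sin (\<omega> * t)\<bar>\<^sup>2 \<le> \<bar>d2\<bar> * \<gamma>\<^sup>2" by (intro mult_left_mono) auto
        then have "\<bar>d2 * (\<gamma> * sin (\<omega> * t))\<^sup>2\<bar> \<le> \<bar>d2\<bar> * \<gamma>\<^sup>2"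
          unfolding power2_abs abs_mult[of d2] abs_power2 .
        moreover have "K * \<gamma> ^ 3 \<le> K * r * \<gamma>\<^sup>2"
          using elim K unfolding power3_eq_cube power2_eq_square mult.assoc
          by (intro mult_left_mono mult_right_mono) auto
        ultimately show "\<bar>d (\<gamma> * sin (\<omega> * t)) - (d0 + d1 * \<gamma> * sin (\<omega> * t))\<bar>
            \<le> (\<bar>d2\<bar> + K * r) * \<gamma>\<^sup>2"
          using cubic[of \<gamma> t] elim by (simp add: algebra_simps)
      qed (use T K r elim contd in \<open>auto intro!: integrable_continuous_interval\<close>)
      then have "\<bar>integral {0..T} (\<lambda>t. d (\<gamma> * sin (\<omega> * t))) - d0 * T\<bar> / T
          \<le> (\<bar>d2\<bar> + K * r) * \<gamma>\<^sup>2"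
        using T by (simp add: divide_le_eq)
      moreover have "(1 / T) * integral {0..T} (\<lambda>t. d (\<gamma> * sin (\<omega> * t))) - d0
          = (integral {0..T} (\<lambda>t. d (\<gamma> * sin (\<omega> * t))) - d0 * T) / T"
        using T by (simp add: field_simps)
      ultimately show ?case using T by simp
    qed
  qed
  show ?sine
  \<comment> \<open>The remainder \<open>K * \<gamma> ^ 3\<close> is integrated over a length
    \<open>T\<close> and multiplied by \<open>2 / T\<close>.\<close>
  proof (rule bigoI[where c = "2 * K"])
    show "\<forall>\<^sub>F \<gamma> in at_right 0.
        norm ((2 / T) * integral {0..T} (\<lambda>t. sin (\<omega> * t) * d (\<gamma> * sin (\<omega> * t))) - \<gamma> * d1)
        \<le> 2 * K * norm (\<gamma> ^ 3)"
      using ev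
    proof eventually_elim
      case (elim \<gamma>)
      let ?I = "integral {0..T} (\<lambda>t. sin (\<omega> * t) * d (\<gamma> * sin (\<omega> * t)))"
      let ?q = "\<lambda>t. d0 * sin (\<omega> * t) + d1 * \<gamma> * sin (\<omega> * t) ^ 2 + d2 * \<gamma>\<^sup>2 * sin (\<omega> * t) ^ 3"
      have "(?q has_integral d0 * 0 + d1 * \<gamma> * (pi / \<omega>) + d2 * \<gamma>\<^sup>2 * 0) {0..T}"
        by (intro has_integral_add has_integral_mult_right sins)
      \<comment> \<open>Here \<open>pi / \<omega>\<close> is \<open>T / 2\<close>, which the
        normalisation \<open>2 / T\<close> cancels.\<close>
      then have q: "(?q has_integral d1 * \<gamma> * T / 2) {0..T}" by (simp add: T_def mult.assoc)
      have "\<bar>?I - d1 * \<gamma> * T / 2\<bar> \<le> K * \<gamma> ^ 3 * (T - 0)"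
      proof (rule abs_integral_diff_le[OF _ _ _ q])
        fix t
        let ?e = "d (\<gamma> * sin (\<omega> * t)) - (d0 + d1 * (\<gamma> * sin (\<omega> * t)) + d2 * (\<gamma> * sin (\<omega> * t))\<^sup>2)"
        have "sin (\<omega> * t) * d (\<gamma> * sin (\<omega> * t)) - ?q t = sin (\<omega> * t) * ?e"
          by (simp add: algebra_simps power2_eq_square power3_eq_cube)
        also have "\<bar>\<dots>\<bar> \<le> 1 * \<bar>?e\<bar>" unfolding abs_mult by (intro mult_right_mono) auto
        also have "\<dots> \<le> K * \<gamma> ^ 3" using cubic[of \<gamma> t] elim by simp
        finally show "\<bar>sin (\<omega> * t) * d (\<gamma> * sin (\<omega> * t)) - ?q t\<bar> \<le> K * \<gamma> ^ 3" .
      qed (use T K r elim contd in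
          \<open>auto intro!: integrable_continuous_interval continuous_intros\<close>)
      then have "2 / T * \<bar>?I - d1 * \<gamma> * T / 2\<bar> \<le> 2 / T * (K * \<gamma> ^ 3 * (T - 0))"
        using T by (intro mult_left_mono) auto
      also have "\<dots> = 2 * K * \<gamma> ^ 3" using T by simp
      finally have "\<bar>2 / T * (?I - d1 * \<gamma> * T / 2)\<bar> \<le> 2 * K * \<gamma> ^ 3"
        unfolding abs_mult using T by simp
      moreover have "2 / T * (?I - d1 * \<gamma> * T / 2) = 2 / T * ?I - \<gamma> * d1"
        using T by (simp add: field_simps)
      ultimately have "\<bar>2 / T * ?I - \<gamma> * d1\<bar> \<le> 2 * K * \<gamma> ^ 3" by (simp only:)
      then show ?case using elim by simp
    qed
  qed
qed

text \<open>The third derivative is continuous on a compact interval, hence bounded, and a sixth of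
  its bound serves as \<open>K\<close> in the Lagrange remainder.\<close>

lemma taylor_remainder_cubic:
  fixes f f1 f2 f3 :: "real \<Rightarrow> real"
  assumes "r > 0"
    and f: "\<And>\<beta>. \<bar>\<beta>\<bar> \<le> r \<Longrightarrow> (f has_real_derivative f1 \<beta>) (at \<beta>)"
    and f1: "\<And>\<beta>. \<bar>\<beta>\<bar> \<le> r \<Longrightarrow> (f1 has_real_derivative f2 \<beta>) (at \<beta>)"
    and f2: "\<And>\<beta>. \<bar>\<beta>\<bar> \<le> r \<Longrightarrow> (f2 has_real_derivative f3 \<beta>) (at \<beta>)"
    and f3: "continuous_on {-r..r} f3"
  shows "\<exists>K. \<forall>\<beta>. \<bar>\<beta>\<bar> \<le> r \<longrightarrow> \<bar>f \<beta> - (f 0 + f1 0 * \<beta> + f2 0 / 2 * \<beta>\<^sup>2)\<bar> \<le> K * \<bar>\<beta>\<bar> ^ 3"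
proof -
  obtain B where B: "\<And>\<beta>. \<beta> \<in> {-r..r} \<Longrightarrow> \<bar>f3 \<beta>\<bar> \<le> B"
    using compact_imp_bounded[OF compact_continuous_image[OF f3 compact_Icc]]
    unfolding bounded_real by blast
  have "\<bar>f \<beta> - (f 0 + f1 0 * \<beta> + f2 0 / 2 * \<beta>\<^sup>2)\<bar> \<le> B / 6 * \<bar>\<beta>\<bar> ^ 3" if \<beta>: "\<bar>\<beta>\<bar> \<le> r" for \<beta>
  proof (cases "\<beta> = 0")
    case False
    define diff where "diff n = [f, f1, f2, f3] ! n" for n
    have "\<forall>m t. m < 3 \<and> -r \<le> t \<and> t \<le> r \<longrightarrow> (diff m has_real_derivative diff (Suc m) t) (at t)"
      using f f1 f2 by (auto simp: diff_def numeral_eq_Suc less_Suc_eq)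
    moreover have "-r \<le> 0" "0 \<le> r" "-r \<le> \<beta>" "\<beta> \<le> r" using \<beta> \<open>r > 0\<close> by auto
    ultimately have "\<exists>t. (if \<beta> < 0 then \<beta> < t \<and> t < 0 else 0 < t \<and> t < \<beta>) \<and>
        f \<beta> = (\<Sum>m<3. diff m 0 / fact m * (\<beta> - 0) ^ m) + diff 3 t / fact 3 * (\<beta> - 0) ^ 3"
      using False by (intro Taylor) (auto simp: diff_def)
    then obtain t where t: "if \<beta> < 0 then \<beta> < t \<and> t < 0 else 0 < t \<and> t < \<beta>"
      and eq: "f \<beta> = (\<Sum>m<3. diff m 0 / fact m * \<beta> ^ m) + diff 3 t / fact 3 * \<beta> ^ 3"
      by auto
    have "f \<beta> - (f 0 + f1 0 * \<beta> + f2 0 / 2 * \<beta>\<^sup>2) = f3 t / 6 * \<beta> ^ 3"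
      unfolding eq by (simp add: eval_nat_numeral diff_def)
    moreover have "\<bar>f3 t\<bar> \<le> B" using t \<beta> by (intro B) (auto split: if_splits)
    ultimately show ?thesis
      by (simp only: abs_mult power_abs) (intro mult_right_mono, auto)
  qed auto
  then show ?thesis by blast
qed

section \<open>Iterated continuous differentiability\<close>

lemma cont_diff_on_Suc_imp_continuous_on:
  assumes "cont_diff_on (Suc n) f S"
  shows "continuous_on S f"
  using assms by (auto intro!: differentiable_imp_continuous_on differentiable_at_imp_differentiable_on)

lemma cont_diff_on_SucD: "cont_diff_on (Suc n) f S \<Longrightarrow> cont_diff_on n f S"
proof (induction n arbitrary: f)
  case 0
  then show ?case by (simp add: cont_diff_on_Suc_imp_continuous_on del: cont_diff_on.simps(2))
next
  case (Suc n)
  then show ?case using cont_diff_on.simps(2)[of "Suc n" f S] cont_diff_on.simps(2)[of n f S] by blast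
qed

text \<open>Turns the Frechet derivative in the basis direction \<open>(0, 1)\<close> into an
  ordinary derivative in the nudging strength, so that one-variable Taylor expansion applies to the
  state and its successive partial derivatives.\<close>

lemma cont_diff_on_has_partial_derivative:
  fixes f :: "'a::euclidean_space \<times> real \<Rightarrow> 'b::real_normed_vector"
  assumes "cont_diff_on (Suc n) f S" "(s, \<beta>) \<in> S"
  shows "((\<lambda>\<beta>. f (s, \<beta>)) has_vector_derivative frechet_derivative f (at (s, \<beta>)) (0, 1)) (at \<beta>)"
proof -
  have D: "(f has_derivative frechet_derivative f (at (s, \<beta>))) (at (s, \<beta>))"
    using assms by (simp add: frechet_derivative_works)
  have "((\<lambda>\<beta>. (s, \<beta>)) has_derivative (\<lambda>h. (0, h))) (at \<beta>)"
    by (auto intro!: derivative_eq_intros)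
  from has_derivative_compose[OF this D]
  have "((\<lambda>\<beta>. f (s, \<beta>)) has_derivative (\<lambda>h. frechet_derivative f (at (s, \<beta>)) (0, h))) (at \<beta>)" .
  moreover have "(\<lambda>h. frechet_derivative f (at (s, \<beta>)) (0, h)) =
      (\<lambda>h. h *\<^sub>R frechet_derivative f (at (s, \<beta>)) (0, 1))"
  proof
    show "frechet_derivative f (at (s, \<beta>)) (0, h) =
        h *\<^sub>R frechet_derivative f (at (s, \<beta>)) (0, 1)" for h
      using linear_scale[OF has_derivative_linear[OF D], of h "(0, 1)"] by simp
  qed
  ultimately show ?thesis unfolding has_vector_derivative_def by (simp only:)
qed

section \<open>Nudged states as minimisers, and the derivative of the cost\<close>

text \<open>Splitting off one summand exhibits the energy as affine in a single conductance, which
  is where concavity of the minimal energy comes from.\<close>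

lemma linear_energy_fun_upd:
  assumes "(j, k) \<in> linear_branches net"
  shows "linear_energy net (\<theta>((j, k) := s)) v =
    linear_energy net (\<theta>((j, k) := 0)) v + s * ((v $ j - v $ k)\<^sup>2 / 2)"
proof -
  have fin: "finite (linear_branches net)" by simp
  show ?thesis
    unfolding linear_energy_def sum.remove[OF fin assms]
    by (simp add: algebra_simps) (auto intro!: sum.cong split: if_splits)
qed

lemma input_energy_not_MInfty: "input_energy net x v \<noteq> - \<infinity>"
  by (auto simp: input_energy_def split: input_mode.split)

text \<open>The configuration \<open>x\<close> itself meets the clamping condition, so it is a
  competitor of finite energy in either input mode.\<close>

lemma is_nudged_state_finite:
  assumes "is_nudged_state net C \<theta> x y \<beta> v"
  shows "\<bar>input_energy net x v\<bar> \<noteq> \<infinity>"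
proof -
  have "input_energy net x x \<noteq> \<infinity>"
    by (auto simp: input_energy_def split: input_mode.split)
  then have "energy net \<theta> x x + ereal (\<beta> * C x y) < \<infinity>" by (simp add: energy_def)
  moreover have "energy net \<theta> x v + ereal (\<beta> * C v y) \<le> energy net \<theta> x x + ereal (\<beta> * C x y)"
    using assms unfolding is_nudged_state_def is_arg_min_def by (simp add: not_less)
  ultimately have "energy net \<theta> x v + ereal (\<beta> * C v y) < \<infinity>" by (rule le_less_trans[rotated])
  then have "input_energy net x v \<noteq> \<infinity>" by (auto simp: energy_def)
  then show ?thesis using input_energy_not_MInfty[of net x v] by auto
qed

text \<open>Between configurations of finite input energy the extended-real minimality becomes a
  real inequality, ready for linear arithmetic.\<close>

lemma is_nudged_state_le:
  assumes "is_nudged_state net C \<theta> x y \<beta> v" "\<bar>input_energy net x w\<bar> \<noteq> \<infinity>"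
  shows "real_of_ereal (input_energy net x v) + nonlinear_energy net v + linear_energy net \<theta> v + \<beta> * C v y
    \<le> real_of_ereal (input_energy net x w) + nonlinear_energy net w + linear_energy net \<theta> w + \<beta> * C w y"
proof -
  obtain a b where "input_energy net x v = ereal a" "input_energy net x w = ereal b"
    using is_nudged_state_finite[OF assms(1)] assms(2) by auto
  moreover have "energy net \<theta> x v + ereal (\<beta> * C v y) \<le> energy net \<theta> x w + ereal (\<beta> * C w y)"
    using assms(1) unfolding is_nudged_state_def is_arg_min_def by (simp add: not_less)
  ultimately show ?thesis by (simp add: energy_def)
qed

text \<open>An instance of \<open>envelope_mixed_partial\<close>: the state that is optimal for
  \<open>z\<close> is a competitor in the problem for \<open>w\<close>, and affinity in the two
  parameters makes this comparison the supergradient inequality. The role of \<open>h\<close> falls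
  to the \<beta>-derivative of half the squared potential difference.\<close>

lemma nudged_state_mixed_partial:
  fixes net :: "'n::finite network" and W :: "real \<times> real \<Rightarrow> real ^ 'n"
  assumes jk: "(j, k) \<in> linear_branches net"
    and U: "open U" "(s0, 0) \<in> U"
    and nudged: "\<And>s \<beta>. (s, \<beta>) \<in> U \<Longrightarrow>
      is_nudged_state net C (\<theta>((j, k) := s)) x y \<beta> (W (s, \<beta>))"
    and W: "cont_diff_on 2 W U"
    and C: "((\<lambda>z. C (W z) y) has_derivative c') (at (s0, 0))"
  defines "W' \<equiv> \<lambda>z. frechet_derivative W (at z) (0, 1)"
  shows "c' (1, 0) =
    (W (s0, 0) $ j - W (s0, 0) $ k) * (W' (s0, 0) $ j - W' (s0, 0) $ k)"
proof (rule envelope_mixed_partial[OF U _ _ _ _ C])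
  \<comment> \<open>The part of the energy free of both parameters: with the conductance of
    \<open>(j, k)\<close> set to 0, \<open>s\<close> enters only through the product with
    \<open>?g\<close>. At nudged states the input energy is finite, so \<open>real_of_ereal\<close>
    loses nothing.\<close>
  define e where "e v = real_of_ereal (input_energy net x v) + nonlinear_energy net v
    + linear_energy net (\<theta>((j, k) := 0)) v" for v
  let ?g = "\<lambda>z. (W z $ j - W z $ k)\<^sup>2 / 2"
  show "e (W w) + fst w * ?g w + snd w * C (W w) y
      \<le> e (W z) + fst z * ?g z + snd z * C (W z) y + (fst w - fst z) * ?g z
        + (snd w - snd z) * C (W z) y" if "z \<in> U" "w \<in> U" for z w
  proof -
    have "is_nudged_state net C (\<theta>((j, k) := fst w)) x y (snd w) (W w)"
      using nudged[of "fst w" "snd w"] that by simp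
    moreover have "\<bar>input_energy net x (W z)\<bar> \<noteq> \<infinity>"
      using nudged[of "fst z" "snd z"] that by (intro is_nudged_state_finite) simp
    ultimately have "e (W w) + fst w * ?g w + snd w * C (W w) y
        \<le> e (W z) + fst w * ?g z + snd w * C (W z) y"
      using is_nudged_state_le[of net C "\<theta>((j, k) := fst w)" x y "snd w" "W w" "W z"]
      unfolding linear_energy_fun_upd[OF jk, of \<theta> "fst w"] e_def by linarith
    also have "\<dots> = e (W z) + fst z * ?g z + snd z * C (W z) y + (fst w - fst z) * ?g z
        + (snd w - snd z) * C (W z) y"
      unfolding left_diff_distrib by simp
    finally show ?thesis .
  qed
  have W1: "cont_diff_on (Suc 1) W U" using W by (simp add: numeral_2_eq_2)
  have "cont_diff_on 1 W' U"
    using W by (auto simp: numeral_2_eq_2 W'_def Basis_prod_def)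
  then have contW': "continuous_on U W'"
    unfolding One_nat_def by (rule cont_diff_on_Suc_imp_continuous_on)
  have contW: "continuous_on U W"
    using W1 by (rule cont_diff_on_Suc_imp_continuous_on)
  show "continuous_on U ?g" by (intro continuous_intros contW) simp
  have "continuous_on U (\<lambda>z. (W z $ j - W z $ k) * (W' z $ j - W' z $ k))"
    by (intro continuous_intros contW contW')
  then show "isCont (\<lambda>z. (W z $ j - W z $ k) * (W' z $ j - W' z $ k)) (s0, 0)"
    using U continuous_on_eq_continuous_at by blast
  show "((\<lambda>\<beta>. (W (s, \<beta>) $ j - W (s, \<beta>) $ k)\<^sup>2 / 2) has_real_derivative
      (W (s, \<beta>) $ j - W (s, \<beta>) $ k) * (W' (s, \<beta>) $ j - W' (s, \<beta>) $ k)) (at \<beta>)"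
    if "(s, \<beta>) \<in> U" for s \<beta>
  proof -
    have "((\<lambda>\<beta>. W (s, \<beta>) $ i) has_real_derivative W' (s, \<beta>) $ i) (at \<beta>)" for i
      using bounded_linear.has_vector_derivative[OF bounded_linear_vec_nth
          cont_diff_on_has_partial_derivative[OF W1 that]]
      by (simp add: W'_def has_real_derivative_iff_has_vector_derivative)
    note this[derivative_intros]
    show ?thesis by (auto intro!: derivative_eq_intros)
  qed
qed

section \<open>Expansion of the learning rule\<close>

text \<open>The potential difference \<open>L\<close> is linear and commutes with the Fourier
  integrals, so the update is a product of two coefficients of the scalar response
  \<open>L \<circ> H\<close>.\<close>

lemma conductance_update_asymp:
  fixes H :: "real \<Rightarrow> real ^ 'n::finite"
  assumes \<omega>: "\<omega> > 0" and r: "r > 0"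
    and H: "\<And>\<beta>. \<bar>\<beta>\<bar> \<le> r \<Longrightarrow> (H has_vector_derivative H1 \<beta>) (at \<beta>)"
      "\<And>\<beta>. \<bar>\<beta>\<bar> \<le> r \<Longrightarrow> (H1 has_vector_derivative H2 \<beta>) (at \<beta>)"
      "\<And>\<beta>. \<bar>\<beta>\<bar> \<le> r \<Longrightarrow> (H2 has_vector_derivative H3 \<beta>) (at \<beta>)"
      "continuous_on {-r..r} H3"
  shows "(\<lambda>\<gamma>. conductance_update \<alpha> \<omega> (\<lambda>t. H (\<gamma> * sin (\<omega> * t))) j k
      - (- \<alpha> * \<gamma> * ((H 0 $ j - H 0 $ k) * (H1 0 $ j - H1 0 $ k)))) \<in> O[at_right 0](\<lambda>\<gamma>. \<gamma> ^ 3)"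
proof -
  define L :: "real ^ 'n \<Rightarrow> real" where "L v = v $ j - v $ k" for v
  have L: "bounded_linear L"
    unfolding L_def by (intro bounded_linear_sub bounded_linear_vec_nth)
  define T where "T = 2 * pi / \<omega>"
  define d where "d = L \<circ> H"
  have "\<exists>K. \<forall>\<beta>. \<bar>\<beta>\<bar> \<le> r \<longrightarrow>
      \<bar>L (H \<beta>) - (L (H 0) + L (H1 0) * \<beta> + L (H2 0) / 2 * \<beta>\<^sup>2)\<bar> \<le> K * \<bar>\<beta>\<bar> ^ 3"
    using bounded_linear.has_vector_derivative[OF L H(1)]
      bounded_linear.has_vector_derivative[OF L H(2)]
      bounded_linear.has_vector_derivative[OF L H(3)]
      bounded_linear.continuous_on[OF L H(4)] r
    by (intro taylor_remainder_cubic[where ?f3.0 = "\<lambda>\<beta>. L (H3 \<beta>)"])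
      (simp_all add: has_real_derivative_iff_has_vector_derivative)
  then obtain K where K: "\<And>\<beta>. \<bar>\<beta>\<bar> \<le> r \<Longrightarrow>
      \<bar>d \<beta> - (L (H 0) + L (H1 0) * \<beta> + L (H2 0) / 2 * \<beta>\<^sup>2)\<bar> \<le> K * \<bar>\<beta>\<bar> ^ 3"
    unfolding d_def by auto
  have contH: "continuous_on {-r..r} H"
    by (auto intro!: continuous_at_imp_continuous_on has_vector_derivative_continuous[OF H(1)])
  then have contd: "continuous_on {-r..r} d"
    unfolding d_def comp_def by (rule bounded_linear.continuous_on[OF L])
  define A where "A \<gamma> = (1 / T) * integral {0..T} (\<lambda>t. d (\<gamma> * sin (\<omega> * t)))" for \<gamma>
  define B where "B \<gamma> = (2 / T) * integral {0..T} (\<lambda>t. sin (\<omega> * t) * d (\<gamma> * sin (\<omega> * t)))" for \<gamma>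
  have bigA: "(\<lambda>\<gamma>. A \<gamma> - L (H 0)) \<in> O[at_right 0](\<lambda>\<gamma>. \<gamma> ^ 2)"
    and bigB: "(\<lambda>\<gamma>. B \<gamma> - \<gamma> * L (H1 0)) \<in> O[at_right 0](\<lambda>\<gamma>. \<gamma> ^ 3)"
    unfolding A_def B_def T_def
    using fourier_coefficients_sinusoidal[OF \<omega> r contd K] by simp_all
  \<comment> \<open>For \<gamma> < r the argument of \<open>H\<close> stays in the interval on which
    \<open>H\<close> is known to be continuous. This provides the integrability required for moving
    \<open>L\<close> inside the integrals.\<close>
  have update: "\<forall>\<^sub>F \<gamma> in at_right 0.
      conductance_update \<alpha> \<omega> (\<lambda>t. H (\<gamma> * sin (\<omega> * t))) j k = - \<alpha> * B \<gamma> * A \<gamma>"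
    using eventually_at_right_real[OF r]
  proof eventually_elim
    case (elim \<gamma>)
    have "\<bar>\<gamma> * sin (\<omega> * t)\<bar> \<le> r" for t
    proof -
      have "\<bar>\<gamma> * sin (\<omega> * t)\<bar> = \<gamma> * \<bar>sin (\<omega> * t)\<bar>"
        using elim by (simp add: abs_mult)
      also have "\<dots> \<le> \<gamma>" using elim by (intro mult_left_le) auto
      finally show ?thesis using elim by simp
    qed
    then have "\<gamma> * sin (\<omega> * t) \<in> {-r..r}" for t
      by (simp only: atLeastAtMost_iff abs_le_iff minus_le_iff)
    then have cont: "continuous_on {0..T} (\<lambda>t. H (\<gamma> * sin (\<omega> * t)))"
      by (intro continuous_on_compose2[OF contH] continuous_intros) auto
    have A: "L (fourier_mean \<omega> (\<lambda>t. H (\<gamma> * sin (\<omega> * t)))) = A \<gamma>"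
      using integral_linear[OF integrable_continuous_interval[OF cont] L]
      by (simp add: fourier_mean_def A_def d_def comp_def T_def linear_scale[OF bounded_linear.linear[OF L]])
    have "continuous_on {0..T} (\<lambda>t. sin (\<omega> * t) *\<^sub>R H (\<gamma> * sin (\<omega> * t)))"
      by (intro continuous_intros cont)
    from integral_linear[OF integrable_continuous_interval[OF this] L]
    have B: "L (fourier_sine \<omega> (\<lambda>t. H (\<gamma> * sin (\<omega> * t)))) = B \<gamma>"
      by (simp add: fourier_sine_def B_def d_def comp_def T_def linear_scale[OF bounded_linear.linear[OF L]])
    show ?case using A B by (simp add: conductance_update_def Let_def L_def)
  qed
  have "(\<lambda>\<gamma>. \<gamma> ^ 2) \<in> O[at_right 0](\<lambda>\<gamma>. 1 :: real)"
    by (intro bigoI_tendsto[where c = 0]) (auto intro!: tendsto_eq_intros)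
  with bigA have "(\<lambda>\<gamma>. A \<gamma> - L (H 0)) \<in> O[at_right 0](\<lambda>\<gamma>. 1)"
    by (rule landau_o.big_trans)
  then have "(\<lambda>\<gamma>. (A \<gamma> - L (H 0)) + L (H 0)) \<in> O[at_right 0](\<lambda>\<gamma>. 1)"
    by (rule sum_in_bigo) simp
  then have A1: "A \<in> O[at_right 0](\<lambda>\<gamma>. 1)" by simp
  \<comment> \<open>The error of the product is split into the error of \<open>B\<close> times the
    bounded \<open>A\<close>, and the main term of \<open>B\<close> times the error of
    \<open>A\<close>. As that main term is itself of order \<gamma>, a quadratic error in
    \<open>A\<close> suffices.\<close>
  have "(\<lambda>\<gamma>. (B \<gamma> - \<gamma> * L (H1 0)) * A \<gamma>) \<in> O[at_right 0](\<lambda>\<gamma>. \<gamma> ^ 3 * 1)"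
    by (intro landau_o.big.mult bigB A1)
  moreover have "(\<lambda>\<gamma>. (\<gamma> * L (H1 0)) * (A \<gamma> - L (H 0))) \<in> O[at_right 0](\<lambda>\<gamma>. \<gamma> * \<gamma> ^ 2)"
    by (intro landau_o.big.mult bigA) simp
  moreover have "(\<lambda>\<gamma>::real. \<gamma> * \<gamma> ^ 2) = (\<lambda>\<gamma>. \<gamma> ^ 3)"
    by (simp add: power2_eq_square power3_eq_cube mult.assoc)
  ultimately have "(\<lambda>\<gamma>. (B \<gamma> - \<gamma> * L (H1 0)) * A \<gamma> + (\<gamma> * L (H1 0)) * (A \<gamma> - L (H 0)))
      \<in> O[at_right 0](\<lambda>\<gamma>. \<gamma> ^ 3)"
    by (intro sum_in_bigo) simp_all
  moreover have "(\<lambda>_. - \<alpha>) \<in> O[at_right 0](\<lambda>_. 1 :: real)" by simp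
  ultimately have "(\<lambda>\<gamma>. - \<alpha> * ((B \<gamma> - \<gamma> * L (H1 0)) * A \<gamma> + (\<gamma> * L (H1 0)) * (A \<gamma> - L (H 0))))
      \<in> O[at_right 0](\<lambda>\<gamma>. 1 * \<gamma> ^ 3)"
    by (rule landau_o.big.mult[rotated])
  then have "(\<lambda>\<gamma>. - \<alpha> * ((B \<gamma> - \<gamma> * L (H1 0)) * A \<gamma> + (\<gamma> * L (H1 0)) * (A \<gamma> - L (H 0))))
      \<in> O[at_right 0](\<lambda>\<gamma>. \<gamma> ^ 3)"
    by (simp only: mult_1)
  moreover have "\<forall>\<^sub>F \<gamma> in at_right 0.
      - \<alpha> * ((B \<gamma> - \<gamma> * L (H1 0)) * A \<gamma> + (\<gamma> * L (H1 0)) * (A \<gamma> - L (H 0)))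
      = conductance_update \<alpha> \<omega> (\<lambda>t. H (\<gamma> * sin (\<omega> * t))) j k
        - (- \<alpha> * \<gamma> * ((H 0 $ j - H 0 $ k) * (H1 0 $ j - H1 0 $ k)))"
    using update by eventually_elim (simp add: L_def algebra_simps)
  ultimately show ?thesis by (rule landau_o.big.in_cong[THEN iffD1, rotated])
qed

section \<open>Gradient of the loss and the learning rule combined\<close>

theorem theorem2:
  fixes net :: "'n::finite network"
    and C :: "real ^ 'n \<Rightarrow> 'y \<Rightarrow> real"
    and \<theta> :: "'n \<times> 'n \<Rightarrow> real"
    and x :: "real ^ 'n"
    and y :: 'y
    and V :: "('n \<times> 'n \<Rightarrow> real) \<Rightarrow> real \<Rightarrow> real ^ 'n"
    and \<omega> \<alpha> :: real
    and j k :: 'n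
    and U :: "(real \<times> real) set"
  assumes "\<omega> > 0" and "\<alpha> > 0"
    and "\<And>i. i \<notin> input_nodes net \<Longrightarrow> x $ i = 0"
    and "(j, k) \<in> linear_branches net"
    and "open U" and "(\<theta> (j, k), 0) \<in> U"
    and "\<And>s \<beta>. (s, \<beta>) \<in> U \<Longrightarrow>
           is_nudged_state net C (\<theta>((j, k) := s)) x y \<beta> (V (\<theta>((j, k) := s)) \<beta>)"
    and "cont_diff_on 3 (\<lambda>(s, \<beta>). V (\<theta>((j, k) := s)) \<beta>) U"
    and "(\<lambda>v. C v y) differentiable (at (V \<theta> 0))"
  shows "(\<lambda>s. loss C V y (\<theta>((j, k) := s))) differentiable (at (\<theta> (j, k))) \<and>
    (\<lambda>\<gamma>. conductance_update \<alpha> \<omega> (\<lambda>t. V \<theta> (\<gamma> * sin (\<omega> * t))) j k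
        - (- \<alpha> * \<gamma> * deriv (\<lambda>s. loss C V y (\<theta>((j, k) := s))) (\<theta> (j, k))))
      \<in> O[at_right 0](\<lambda>\<gamma>. \<gamma> ^ 3)"
proof -
  define s0 where "s0 = \<theta> (j, k)"
  define W where "W = (\<lambda>(s, \<beta>). V (\<theta>((j, k) := s)) \<beta>)"
  define D where "D f z = frechet_derivative f (at z) (0, 1)"
    for f :: "real \<times> real \<Rightarrow> real ^ 'n" and z
  have U: "open U" "(s0, 0) \<in> U" using assms(5,6) by (auto simp: s0_def)
  have W_s0: "W (s0, \<beta>) = V \<theta> \<beta>" for \<beta> by (simp add: W_def s0_def)
  \<comment> \<open>Each derivative in \<beta> consumes one order of smoothness. Three orders yield
    the three derivatives that the cubic Taylor remainder uses, the last of them continuous.\<close>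
  have CD: "cont_diff_on n (D f) U" if "cont_diff_on (Suc n) f U" for n f
    using that by (auto simp: D_def[abs_def] Basis_prod_def)
  have W3: "cont_diff_on (Suc 2) W U" using assms(8) by (simp add: W_def)
  have W2: "cont_diff_on (Suc 1) (D W) U" using CD[OF W3] by (simp add: numeral_2_eq_2)
  have W1: "cont_diff_on (Suc 0) (D (D W)) U" using CD[OF W2] by simp
  have W0: "continuous_on U (D (D (D W)))" using CD[OF W1] by simp
  have dW: "W differentiable (at (s0, 0))" using W3 U(2) unfolding cont_diff_on.simps by blast
  have "(\<lambda>z. C (W z) y) differentiable (at (s0, 0))"
    using differentiable_compose[OF _ dW, of "\<lambda>v. C v y"] assms(9) by (simp add: W_s0)
  then obtain c' where c': "((\<lambda>z. C (W z) y) has_derivative c') (at (s0, 0))"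
    by (auto simp: differentiable_def)
  have key: "c' (1, 0) = (W (s0, 0) $ j - W (s0, 0) $ k) * (D W (s0, 0) $ j - D W (s0, 0) $ k)"
    unfolding D_def
  proof (rule nudged_state_mixed_partial[where W = W and C = C and y = y and c' = c', OF assms(4) U _ _ c'])
    show "cont_diff_on 2 W U" using W3 by (rule cont_diff_on_SucD)
    show "is_nudged_state net C (\<theta>((j, k) := s)) x y \<beta> (W (s, \<beta>))" if "(s, \<beta>) \<in> U" for s \<beta>
      using assms(7)[OF that] by (simp add: W_def)
  qed
  \<comment> \<open>The loss is the cost restricted to the line of zero nudging, so its derivative
    in the conductance is \<open>c' (1, 0)\<close>, the quantity identified in
    \<open>key\<close>.\<close>
  have "((\<lambda>s. (s, 0::real)) has_derivative (\<lambda>h. (h, 0))) (at s0)"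
    by (auto intro!: derivative_eq_intros)
  from has_derivative_compose[OF this c']
  have "((\<lambda>s. C (W (s, 0)) y) has_derivative (\<lambda>h. c' (h, 0))) (at s0)" .
  moreover have "(\<lambda>h. c' (h, 0)) = (*) (c' (1, 0))"
  proof
    show "c' (h, 0) = c' (1, 0) * h" for h
      using linear_scale[OF has_derivative_linear[OF c'], of h "(1, 0)"] by (simp add: mult.commute)
  qed
  ultimately have "((\<lambda>s. C (W (s, 0)) y) has_real_derivative c' (1, 0)) (at s0)"
    unfolding has_field_derivative_def by (simp only:)
  then have loss: "((\<lambda>s. loss C V y (\<theta>((j, k) := s))) has_real_derivative c' (1, 0)) (at (\<theta> (j, k)))"
    by (simp add: loss_def W_def s0_def)
  \<comment> \<open>A closed ball inside \<open>U\<close> contains the whole segment over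
    \<open>{-r..r}\<close> at \<open>s0\<close>, including its end points.\<close>
  obtain r where r: "r > 0" "cball (s0, 0) r \<subseteq> U"
    using U open_contains_cball by blast
  have inU: "(s0, \<beta>) \<in> U" if "\<bar>\<beta>\<bar> \<le> r" for \<beta>
    using r that by (intro subsetD[OF r(2)]) (simp add: dist_Pair_Pair)
  have "continuous_on {-r..r} (\<lambda>\<beta>. D (D (D W)) (s0, \<beta>))"
    by (intro continuous_on_compose2[OF W0] continuous_intros) (auto intro!: inU)
  from conductance_update_asymp[OF assms(1) r(1)
      cont_diff_on_has_partial_derivative[OF W3 inU, folded D_def]
      cont_diff_on_has_partial_derivative[OF W2 inU, folded D_def]
      cont_diff_on_has_partial_derivative[OF W1 inU, folded D_def] this]
  have "(\<lambda>\<gamma>. conductance_update \<alpha> \<omega> (\<lambda>t. V \<theta> (\<gamma> * sin (\<omega> * t))) j k - (- \<alpha> * \<gamma> * c' (1, 0)))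
      \<in> O[at_right 0](\<lambda>\<gamma>. \<gamma> ^ 3)"
    unfolding key W_s0 .
  moreover have "(\<lambda>s. loss C V y (\<theta>((j, k) := s))) differentiable (at (\<theta> (j, k)))"
    using loss real_differentiable_def by blast
  ultimately show ?thesis unfolding DERIV_imp_deriv[OF loss] by blast
qed

end
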